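(* Let $\mathbb{X}$ be a real reflexive Banach space with dual $\mathbb{X}^*$, and let $g:\mathbb{X}\to\mathbb{R}$ be proper, convex, lower semicontinuous, uniformly Fréchet differentiable, $\gamma$-strongly convex for some $\gamma>0$, strongly coercive and Legendre. Let $\mathcal{A}:\mathbb{X}\to\mathbb{X}^*$ be Lipschitz continuous with constant $L>0$ and let $\mathcal{B}:\mathbb{X}\to 2^{\mathbb{X}^*}$, and suppose that for some $\tau>0$ one of the following holds: (i) $\mathcal{A}$ is monotone and $\mathcal{B}$ is maximal monotone and $\tau$-strongly monotone; or (ii) $\mathcal{A}$ is $\tau$-strongly monotone and $\mathcal{B}$ is maximal monotone. Assume that $(\mathcal{A}+\mathcal{B})^{-1}(0^* ):=\{v\in\mathbb{X}: 0^*\in \mathcal{A}v+\mathcal{B}v\}\neq\emptyset$. Let $\alpha\in(0,1)$ satisfy $\alpha\in\left(\delta,\frac{\gamma(1-2\delta)}{2}\right)$ for some $\delta\in(0,\frac12)$, let $\mu_0,\mu_1>0$, and let $\{d_n\}$ be a nonnegative real sequence with $\sum_{n=1}^\infty d_n<\infty$. For arbitrary $v_0,v_1\in\mathbb{X}$ define, for $n\ge1$, $$v_{n+1}=\mathrm{Res}^g_{\mu_n\mathcal{B}}\Big(\nabla g^*\big(\nabla g(v_n)-\left((\mu_n+\mu_{n-1})\mathcal{A}v_n-\mu_{n-1}\mathcal{A}v_{n-1}\right)\big)\Big),$$ $$\mu_{n+1}=\begin{cases}\min\left\{\dfrac{\alpha\|v_n-v_{n+1}\|}{\|\mathcal{A}v_n-\mathcal{A}v_{n+1}\|},\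 \mu_n+d_n\right\}, & \text{if } \mathcal{A}v_n\neq\mathcal{A}v_{n+1},\\ \mu_n+d_n, & \text{otherwise.}\end{cases}$$ Then the sequence $\{v_n\}$ converges strongly (in norm) to some $u\in(\mathcal{A}+\mathcal{B})^{-1}(0^* )$.
   Context: $0^*$ is the zero of $\mathbb{X}^*$. $g^*(x^* )=\sup_{x\in\mathbb{X}}\{\langle x^*,x\rangle-g(x)\}$ is the Fenchel conjugate of $g$. Conditions on $g$: $g$ is uniformly Fréchet differentiable if the limit $\langle\nabla g(x),y\rangle=\lim_{\lambda\to0}\frac{g(x+\lambda y)-g(x)}{\lambda}$ is attained uniformly for $x\in\mathbb{X}$ and $\|y\|=1$. $g$ is $\gamma$-strongly convex if $\langle\nabla g(x)-\nabla g(y),x-y\rangle\ge\gamma\|x-y\|^2$ for all $x,y$. $g$ is strongly coercive if $g(x)/\|x\|\to+\infty$ as $\|x\|\to\infty$. $g$ is Legendre if $g$ and $g^*$ are Gâteaux differentiable on the interiors of their domains, these interiors are nonempty, and the domains of $\nabla g$ and $\nabla g^*$ equal $\mathrm{int}(\mathrm{dom}\, g)$ and $\mathrm{int}(\mathrm{dom}\, g^* )$ respectively. Under these conditions $\nabla g:\mathbb{X}\to\mathbb{X}^*$ is a bijection, $\mathrm{dom}\,g^*=\mathbb{X}^*$ and $\nabla g^*=(\nabla g)^{-1}$. Resolvent: for $\mu>0$, $\mathrm{Res}^g_{\mu\mathcal{B}}:=(\nabla g+\mu\mathcal{B})^{-1}\circ\nabla g$, which is single-valued and everywhere defined for $\mathcal{B}$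 maximal monotone. $\mathcal{A}$ is monotone (resp. $\tau$-strongly monotone) if $\langle\mathcal{A}x-\mathcal{A}y,x-y\rangle\ge0$ (resp. $\ge\tau\|x-y\|^2$) for all $x,y$. $\mathcal{B}$ is monotone (resp. $\tau$-strongly monotone) if $\langle u-v,x-y\rangle\ge 0$ (resp. $\ge\tau\|x-y\|^2$) whenever $u\in\mathcal{B}x$, $v\in\mathcal{B}y$, and maximal monotone if it is monotone and its graph is not properly contained in the graph of another monotone operator. Norms of elements of $\mathbb{X}$ and of $\mathbb{X}^*$ are the norm and dual norm. *)

theory Defs
  imports "HOL-Analysis.Analysis"
begin

section \<open>Reflexivity\<close>

text \<open>The topological dual of \<open>'a\<close> is the type \<open>'a \<Rightarrow>\<^sub>L real\<close>, whose norm is the dual norm.\<close>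

lift_definition bidual_embedding ::
  "'a::real_normed_vector \<Rightarrow> (('a \<Rightarrow>\<^sub>L real) \<Rightarrow>\<^sub>L real)"
  is "\<lambda>x f. blinfun_apply f x"
  by (rule blinfun.bounded_linear_left)

definition reflexive :: "'a::real_normed_vector itself \<Rightarrow> bool" where
  "reflexive TYPE('a) \<longleftrightarrow>
     surj (bidual_embedding :: 'a \<Rightarrow> (('a \<Rightarrow>\<^sub>L real) \<Rightarrow>\<^sub>L real))"

section \<open>Extended-real-valued functions\<close>

definition effective_domain :: "('b \<Rightarrow> ereal) \<Rightarrow> 'b set" where
  "effective_domain f = {x. f x < \<infinity>}"

definition proper_function :: "('b \<Rightarrow> ereal) \<Rightarrow> bool" where
  "proper_function f \<longleftrightarrow> effective_domain f \<noteq> {} \<and> (\<forall>x. f x \<noteq> -\<infinity>)"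

definition lower_semicontinuous :: "('b::topological_space \<Rightarrow> ereal) \<Rightarrow> bool" where
  "lower_semicontinuous f \<longleftrightarrow> (\<forall>x. f x \<le> Liminf (at x) f)"

definition fenchel_conjugate ::
  "('b::real_normed_vector \<Rightarrow> ereal) \<Rightarrow> ('b \<Rightarrow>\<^sub>L real) \<Rightarrow> ereal" where
  "fenchel_conjugate f u = (SUP x. ereal (blinfun_apply u x) - f x)"

text \<open>Convergence in \<open>ereal\<close> to a finite limit forces \<open>f (x + t *\<^sub>R y)\<close> to be finite for
  all small \<open>t\<close>, so a point with a Gateaux gradient lies in the algebraic interior of the
  effective domain.\<close>

definition has_gateaux_gradient ::
  "('b::real_normed_vector \<Rightarrow> ereal) \<Rightarrow> ('b \<Rightarrow>\<^sub>L real) \<Rightarrow> 'b \<Rightarrow> bool" where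
  "has_gateaux_gradient f l x \<longleftrightarrow>
     \<bar>f x\<bar> \<noteq> \<infinity> \<and>
     (\<forall>y. ((\<lambda>t. (f (x + t *\<^sub>R y) - f x) / ereal t) \<longlongrightarrow> ereal (blinfun_apply l y)) (at 0))"

definition gateaux_differentiable_at ::
  "('b::real_normed_vector \<Rightarrow> ereal) \<Rightarrow> 'b \<Rightarrow> bool" where
  "gateaux_differentiable_at f x \<longleftrightarrow> (\<exists>l. has_gateaux_gradient f l x)"

definition gateaux_gradient ::
  "('b::real_normed_vector \<Rightarrow> ereal) \<Rightarrow> 'b \<Rightarrow> ('b \<Rightarrow>\<^sub>L real)" where
  "gateaux_gradient f x = (THE l. has_gateaux_gradient f l x)"

definition gradient_domain :: "('b::real_normed_vector \<Rightarrow> ereal) \<Rightarrow> 'b set" where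
  "gradient_domain f = {x. gateaux_differentiable_at f x}"

definition legendre :: "('a::real_normed_vector \<Rightarrow> ereal) \<Rightarrow> bool" where
  "legendre f \<longleftrightarrow>
     interior (effective_domain f) \<noteq> {} \<and>
     (\<forall>x \<in> interior (effective_domain f). gateaux_differentiable_at f x) \<and>
     gradient_domain f = interior (effective_domain f) \<and>
     interior (effective_domain (fenchel_conjugate f)) \<noteq> {} \<and>
     (\<forall>u \<in> interior (effective_domain (fenchel_conjugate f)).
        gateaux_differentiable_at (fenchel_conjugate f) u) \<and>
     gradient_domain (fenchel_conjugate f) = interior (effective_domain (fenchel_conjugate f))"

section \<open>Finite-valued functions\<close>

abbreviation grad :: "('a::real_normed_vector \<Rightarrow> real) \<Rightarrow> 'a \<Rightarrow> ('a \<Rightarrow>\<^sub>L real)" where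
  "grad g \<equiv> gateaux_gradient (\<lambda>x. ereal (g x))"

text \<open>The gradient of the conjugate lives in the bidual and is pulled back along the canonical
  embedding, which is a bijection when \<open>'a\<close> is reflexive.\<close>

definition grad_conjugate :: "('a::real_normed_vector \<Rightarrow> real) \<Rightarrow> ('a \<Rightarrow>\<^sub>L real) \<Rightarrow> 'a" where
  "grad_conjugate g u =
     inv bidual_embedding (gateaux_gradient (fenchel_conjugate (\<lambda>x. ereal (g x))) u)"

definition uniformly_frechet_differentiable :: "('a::real_normed_vector \<Rightarrow> real) \<Rightarrow> bool" where
  "uniformly_frechet_differentiable g \<longleftrightarrow>
     (\<forall>x. gateaux_differentiable_at (\<lambda>z. ereal (g z)) x) \<and>
     uniform_limit (UNIV \<times> sphere 0 1)
       (\<lambda>t (x, y). (g (x + t *\<^sub>R y) - g x) / t)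
       (\<lambda>(x, y). blinfun_apply (grad g x) y)
       (at 0)"

definition strongly_convex :: "real \<Rightarrow> ('a::real_normed_vector \<Rightarrow> real) \<Rightarrow> bool" where
  "strongly_convex \<gamma> g \<longleftrightarrow>
     (\<forall>x y. blinfun_apply (grad g x - grad g y) (x - y) \<ge> \<gamma> * (norm (x - y))\<^sup>2)"

definition strongly_coercive :: "('a::real_normed_vector \<Rightarrow> real) \<Rightarrow> bool" where
  "strongly_coercive g \<longleftrightarrow> filterlim (\<lambda>x. g x / norm x) at_top at_infinity"

section \<open>Operators into the dual\<close>

definition strongly_monotone_mapping ::
  "real \<Rightarrow> ('a::real_normed_vector \<Rightarrow> ('a \<Rightarrow>\<^sub>L real)) \<Rightarrow> bool" where
  "strongly_monotone_mapping \<tau> A \<longleftrightarrow>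
     (\<forall>x y. blinfun_apply (A x - A y) (x - y) \<ge> \<tau> * (norm (x - y))\<^sup>2)"

definition monotone_mapping :: "('a::real_normed_vector \<Rightarrow> ('a \<Rightarrow>\<^sub>L real)) \<Rightarrow> bool" where
  "monotone_mapping A \<longleftrightarrow> (\<forall>x y. blinfun_apply (A x - A y) (x - y) \<ge> 0)"

definition strongly_monotone_op ::
  "real \<Rightarrow> ('a::real_normed_vector \<Rightarrow> ('a \<Rightarrow>\<^sub>L real) set) \<Rightarrow> bool" where
  "strongly_monotone_op \<tau> B \<longleftrightarrow>
     (\<forall>x y. \<forall>u \<in> B x. \<forall>v \<in> B y. blinfun_apply (u - v) (x - y) \<ge> \<tau> * (norm (x - y))\<^sup>2)"

definition monotone_op :: "('a::real_normed_vector \<Rightarrow> ('a \<Rightarrow>\<^sub>L real) set) \<Rightarrow> bool" where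
  "monotone_op B \<longleftrightarrow> (\<forall>x y. \<forall>u \<in> B x. \<forall>v \<in> B y. blinfun_apply (u - v) (x - y) \<ge> 0)"

definition op_graph :: "('a \<Rightarrow> 'b set) \<Rightarrow> ('a \<times> 'b) set" where
  "op_graph B = {(x, u). u \<in> B x}"

definition maximal_monotone ::
  "('a::real_normed_vector \<Rightarrow> ('a \<Rightarrow>\<^sub>L real) set) \<Rightarrow> bool" where
  "maximal_monotone B \<longleftrightarrow>
     monotone_op B \<and> \<not> (\<exists>C. monotone_op C \<and> op_graph B \<subset> op_graph C)"

definition op_inverse :: "('a \<Rightarrow> 'b set) \<Rightarrow> 'b \<Rightarrow> 'a set" where
  "op_inverse T u = {x. u \<in> T x}"

definition zeros_of_sum ::
  "('a::real_normed_vector \<Rightarrow> ('a \<Rightarrow>\<^sub>L real)) \<Rightarrow> ('a \<Rightarrow> ('a \<Rightarrow>\<^sub>L real) set) \<Rightarrow> 'a set" where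
  "zeros_of_sum A B = op_inverse (\<lambda>x. {A x + b |b. b \<in> B x}) 0"

text \<open>The composition \<open>(\<nabla>g + \<mu>B)\<^sup>-\<^sup>1 \<circ> \<nabla>g\<close> as a set-valued operator; its values are singletons
  for maximal monotone \<open>B\<close> and suitable \<open>g\<close>, so membership in the resolvent then determines
  a point.\<close>

definition resolvent ::
  "('a::real_normed_vector \<Rightarrow> real) \<Rightarrow> real \<Rightarrow> ('a \<Rightarrow> ('a \<Rightarrow>\<^sub>L real) set) \<Rightarrow> 'a \<Rightarrow> 'a set" where
  "resolvent g \<mu> B x = op_inverse (\<lambda>z. {grad g z + \<mu> *\<^sub>R b |b. b \<in> B z}) (grad g x)"

end

theory Submission
  imports Defs
begin

text \<open>Both alternatives on \<open>A\<close> and \<open>B\<close> make \<open>A + B\<close> strongly monotone at a zero \<open>u\<close>. Writing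
  \<open>a\<^sub>n = \<mu>\<^sub>n (A v\<^sub>n\<^sub>+\<^sub>1 - A v\<^sub>n)\<close>, one iteration step and the three-point identity for the Bregman distance
  \<open>D\<close> of \<open>g\<close> show that the Lyapunov function
  \<open>\<Phi>\<^sub>n = D(u, v\<^sub>n\<^sub>+\<^sub>1) - \<langle>a\<^sub>n, v\<^sub>n\<^sub>+\<^sub>1 - u\<rangle> + \<beta>/2 \<parallel>v\<^sub>n\<^sub>+\<^sub>1 - v\<^sub>n\<parallel>\<^sup>2\<close> is eventually nonnegative and
  decreases by at least \<open>\<tau> \<mu>\<^sub>n\<^sub>+\<^sub>1 \<parallel>v\<^sub>n\<^sub>+\<^sub>2 - u\<parallel>\<^sup>2\<close>, for any \<open>\<beta>\<close> strictly between \<open>\<alpha>\<close> and \<open>\<gamma>/2\<close>; this works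
  because \<open>\<mu>\<^sub>n\<close> converges to a positive limit, so that \<open>\<parallel>a\<^sub>n\<parallel> \<le> \<beta> \<parallel>v\<^sub>n\<^sub>+\<^sub>1 - v\<^sub>n\<parallel>\<close> from some point on.\<close>

section \<open>Gateaux gradients and subgradients\<close>

lemma has_gateaux_gradient_real_iff:
  "has_gateaux_gradient (\<lambda>z. ereal (F z)) l x \<longleftrightarrow>
     (\<forall>y. ((\<lambda>t. (F (x + t *\<^sub>R y) - F x) / t) \<longlongrightarrow> blinfun_apply l y) (at 0))"
proof -
  have "((\<lambda>t. (ereal (F (x + t *\<^sub>R y)) - ereal (F x)) / ereal t) \<longlongrightarrow> ereal (blinfun_apply l y)) (at 0)
      \<longleftrightarrow> ((\<lambda>t. (F (x + t *\<^sub>R y) - F x) / t) \<longlongrightarrow> blinfun_apply l y) (at 0)" for y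
  proof -
    have "((\<lambda>t. (ereal (F (x + t *\<^sub>R y)) - ereal (F x)) / ereal t) \<longlongrightarrow> ereal (blinfun_apply l y)) (at 0)
      \<longleftrightarrow> ((\<lambda>t. ereal ((F (x + t *\<^sub>R y) - F x) / t)) \<longlongrightarrow> ereal (blinfun_apply l y)) (at 0)"
      by (rule tendsto_cong) (auto simp: eventually_at_filter)
    then show ?thesis by simp
  qed
  then show ?thesis by (simp add: has_gateaux_gradient_def)
qed

lemma has_gateaux_gradient_unique:
  assumes "has_gateaux_gradient f l x" and "has_gateaux_gradient f l' x"
  shows "l = l'"
proof (rule blinfun_eqI)
  fix y
  have "ereal (blinfun_apply l y) = ereal (blinfun_apply l' y)"
    using assms unfolding has_gateaux_gradient_def
    by (intro tendsto_unique[where F = "at (0::real)"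
          and f = "\<lambda>t. (f (x + t *\<^sub>R y) - f x) / ereal t"]) auto
  then show "blinfun_apply l y = blinfun_apply l' y" by simp
qed

lemma gateaux_gradient_has_gradient:
  assumes "gateaux_differentiable_at f x"
  shows "has_gateaux_gradient f (gateaux_gradient f x) x"
  using assms unfolding gateaux_differentiable_at_def gateaux_gradient_def
  by (metis (no_types, lifting) has_gateaux_gradient_unique theI)

text \<open>Convexity bounds every chord slope from \<open>x\<close> towards \<open>z\<close> with 0
  < t < 1 by \<open>F z - F x\<close>, and the bound survives the limit from the right. It is
  applied below to the conjugate of \<open>g\<close>.\<close>

lemma gateaux_gradient_le_if_convex:
  fixes F :: "'b::real_normed_vector \<Rightarrow> real"
  assumes "convex_on UNIV F" and "has_gateaux_gradient (\<lambda>z. ereal (F z)) l x"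
  shows "F x + blinfun_apply l (z - x) \<le> F z"
proof -
  have lim: "((\<lambda>t. (F (x + t *\<^sub>R (z - x)) - F x) / t) \<longlongrightarrow> blinfun_apply l (z - x)) (at_right 0)"
    using assms(2) by (auto simp: has_gateaux_gradient_real_iff intro: filterlim_mono at_le)
  have "(F (x + t *\<^sub>R (z - x)) - F x) / t \<le> F z - F x" if "0 < t" "t < 1" for t
  proof -
    have "F ((1 - t) *\<^sub>R x + t *\<^sub>R z) \<le> (1 - t) * F x + t * F z"
      using assms(1) that by (intro convex_onD) auto
    moreover have "(1 - t) *\<^sub>R x + t *\<^sub>R z = x + t *\<^sub>R (z - x)"
      by (simp add: algebra_simps)
    ultimately show ?thesis using that by (simp add: field_simps)
  qed
  then have "eventually (\<lambda>t. (F (x + t *\<^sub>R (z - x)) - F x) / t \<le> F z - F x) (at_right 0)"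
    using eventually_at_right_real[of 0 1] by (auto elim: eventually_mono)
  then have "blinfun_apply l (z - x) \<le> F z - F x"
    using lim by (intro tendsto_upperbound) auto
  then show ?thesis by simp
qed

text \<open>A subgradient \<open>w\<close> bounds the right difference quotients from below, so
  \<open>w\<close> is at most \<open>l\<close> in every direction; the directions \<open>y\<close>
  and \<open>- y\<close> together force equality.\<close>

lemma gateaux_gradient_eq_subgradient:
  fixes F :: "'b::real_normed_vector \<Rightarrow> real"
  assumes "has_gateaux_gradient (\<lambda>z. ereal (F z)) l x"
    and sub: "\<And>z. F x + blinfun_apply w (z - x) \<le> F z"
  shows "l = w"
proof -
  have le: "blinfun_apply w y \<le> blinfun_apply l y" for y
  proof -
    have "((\<lambda>t. (F (x + t *\<^sub>R y) - F x) / t) \<longlongrightarrow> blinfun_apply l y) (at_right 0)"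
      using assms(1) by (auto simp: has_gateaux_gradient_real_iff intro: filterlim_mono at_le)
    moreover have "eventually (\<lambda>t. blinfun_apply w y \<le> (F (x + t *\<^sub>R y) - F x) / t) (at_right 0)"
      using eventually_at_right_less[of 0]
    proof eventually_elim
      case (elim t)
      then show ?case using sub[of "x + t *\<^sub>R y"]
        by (simp add: blinfun.scaleR_right field_simps)
    qed
    ultimately show ?thesis by (intro tendsto_lowerbound) auto
  qed
  show ?thesis
  proof (rule blinfun_eqI)
    fix y
    show "blinfun_apply l y = blinfun_apply w y"
      using le[of y] le[of "- y"] by (simp add: blinfun.minus_right)
  qed
qed

section \<open>The Bregman distance and its quadratic lower bound\<close>

definition bregman :: "('a::real_normed_vector \<Rightarrow> real) \<Rightarrow> 'a \<Rightarrow> 'a \<Rightarrow> real" where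
  "bregman g x y = g x - g y - blinfun_apply (grad g y) (x - y)"

lemma bregman_three_point:
  "blinfun_apply (grad g y - grad g z) (z - x) = bregman g x y - bregman g x z - bregman g z y"
  by (simp add: bregman_def blinfun.diff_left blinfun.diff_right)

lemma has_gateaux_gradient_grad:
  assumes "uniformly_frechet_differentiable g"
  shows "has_gateaux_gradient (\<lambda>z. ereal (g z)) (grad g x) x"
  using assms gateaux_gradient_has_gradient
  unfolding uniformly_frechet_differentiable_def by blast

lemma DERIV_along_line:
  assumes "uniformly_frechet_differentiable g"
  shows "((\<lambda>t. g (y + t *\<^sub>R h)) has_real_derivative blinfun_apply (grad g (y + t *\<^sub>R h)) h) (at t)"
proof -
  have "((\<lambda>s. (g ((y + t *\<^sub>R h) + s *\<^sub>R h) - g (y + t *\<^sub>R h)) / s)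
      \<longlongrightarrow> blinfun_apply (grad g (y + t *\<^sub>R h)) h) (at 0)"
    using has_gateaux_gradient_grad[OF assms, of "y + t *\<^sub>R h"]
    unfolding has_gateaux_gradient_real_iff by blast
  then show ?thesis by (simp add: DERIV_def algebra_simps)
qed

text \<open>Strong monotonicity of the gradient is integrated along the segment from
  \<open>y\<close> to \<open>x\<close>.\<close>

lemma bregman_ge_norm_square:
  fixes g :: "'a::real_normed_vector \<Rightarrow> real"
  assumes diff: "uniformly_frechet_differentiable g" and sc: "strongly_convex \<gamma> g"
  shows "\<gamma> / 2 * (norm (x - y))\<^sup>2 \<le> bregman g x y"
proof -
  define h where "h = x - y"
  \<comment> \<open>Chosen so that \<open>\<phi> 1 - \<phi> 0\<close> is the difference of the two
    sides of the claim. Its derivative at t > 0 is nonnegative by strong convexity between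
    \<open>y + t *\<^sub>R h\<close> and \<open>y\<close>, after cancelling a factor
    \<open>t\<close>.\<close>
  define \<phi> where "\<phi> t = g (y + t *\<^sub>R h) - t * blinfun_apply (grad g y) h - \<gamma> / 2 * t\<^sup>2 * (norm h)\<^sup>2" for t
  have D: "(\<phi> has_real_derivative
      blinfun_apply (grad g (y + t *\<^sub>R h)) h - blinfun_apply (grad g y) h - \<gamma> * t * (norm h)\<^sup>2) (at t)" for t
    unfolding \<phi>_def by (rule derivative_eq_intros DERIV_along_line[OF diff] refl | simp)+
  have "0 \<le> blinfun_apply (grad g (y + t *\<^sub>R h)) h - blinfun_apply (grad g y) h - \<gamma> * t * (norm h)\<^sup>2"
    if "0 \<le> t" for t
  proof (cases "t = 0")
    case False
    have "\<gamma> * (norm (t *\<^sub>R h))\<^sup>2 \<le> blinfun_apply (grad g (y + t *\<^sub>R h) - grad g y) (t *\<^sub>R h)"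
      using sc[unfolded strongly_convex_def, rule_format, of "y + t *\<^sub>R h" y] by simp
    then have "t * (\<gamma> * t * (norm h)\<^sup>2)
        \<le> t * (blinfun_apply (grad g (y + t *\<^sub>R h)) h - blinfun_apply (grad g y) h)"
      by (simp add: blinfun.scaleR_right blinfun.diff_left power_mult_distrib power2_eq_square
          algebra_simps)
    then show ?thesis using that False by simp
  qed simp
  then have "\<phi> 0 \<le> \<phi> 1"
    using D by (intro DERIV_nonneg_imp_nondecreasing[of 0 1 \<phi>]) (simp, blast)
  then show ?thesis by (simp add: \<phi>_def h_def bregman_def)
qed

section \<open>The Fenchel conjugate and inversion of the gradient\<close>

lemma fenchel_conjugate_at_gradient:
  assumes "\<And>z. g x + blinfun_apply p (z - x) \<le> g z"
  shows "fenchel_conjugate (\<lambda>z. ereal (g z)) p = ereal (blinfun_apply p x - g x)"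
  unfolding fenchel_conjugate_def
proof (rule antisym)
  show "(SUP z. ereal (blinfun_apply p z) - ereal (g z)) \<le> ereal (blinfun_apply p x - g x)"
  proof (rule SUP_least)
    fix z
    show "ereal (blinfun_apply p z) - ereal (g z) \<le> ereal (blinfun_apply p x - g x)"
      using assms[of z] by (simp add: blinfun.diff_right)
  qed
  show "ereal (blinfun_apply p x - g x) \<le> (SUP z. ereal (blinfun_apply p z) - ereal (g z))"
    by (rule SUP_upper2[of x]) auto
qed

lemma fenchel_conjugate_real:
  assumes "fenchel_conjugate (\<lambda>z. ereal (g z)) u < \<infinity>"
  obtains r where "fenchel_conjugate (\<lambda>z. ereal (g z)) u = ereal r"
proof -
  have "ereal (blinfun_apply u 0 - g 0) \<le> fenchel_conjugate (\<lambda>z. ereal (g z)) u"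
    unfolding fenchel_conjugate_def by (rule SUP_upper2[of 0]) auto
  then show ?thesis
    using assms that by (cases "fenchel_conjugate (\<lambda>z. ereal (g z)) u") auto
qed

text \<open>The conjugate is a supremum of the functions \<open>p \<mapsto> p z - g z\<close>, each
  affine in \<open>p\<close>.\<close>

lemma convex_on_fenchel_conjugate:
  assumes G: "\<And>u. fenchel_conjugate (\<lambda>z. ereal (g z)) u = ereal (G u)"
  shows "convex_on UNIV G"
proof (rule convex_onI)
  fix t u w assume t: "(0::real) < t" "t < 1"
  have upper: "blinfun_apply p z - g z \<le> G p" for p z
  proof -
    have "ereal (blinfun_apply p z - g z) \<le> fenchel_conjugate (\<lambda>z. ereal (g z)) p"
      unfolding fenchel_conjugate_def by (rule SUP_upper2[of z]) auto
    then show ?thesis by (simp add: G)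
  qed
  have "fenchel_conjugate (\<lambda>z. ereal (g z)) ((1 - t) *\<^sub>R u + t *\<^sub>R w) \<le> ereal ((1 - t) * G u + t * G w)"
    unfolding fenchel_conjugate_def
  proof (rule SUP_least)
    fix z
    have "(1 - t) * (blinfun_apply u z - g z) + t * (blinfun_apply w z - g z)
        \<le> (1 - t) * G u + t * G w"
      using t upper by (intro add_mono mult_left_mono) auto
    then show "ereal (blinfun_apply ((1 - t) *\<^sub>R u + t *\<^sub>R w) z) - ereal (g z)
        \<le> ereal ((1 - t) * G u + t * G w)"
      by (simp add: blinfun.add_left blinfun.diff_left blinfun.scaleR_left algebra_simps)
  qed
  then show "G ((1 - t) *\<^sub>R u + t *\<^sub>R w) \<le> (1 - t) * G u + t * G w" by (simp add: G)
qed auto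

text \<open>Around 0, \<open>g\<close> grows at least quadratically up to a linear term, which
  dominates the linear functional \<open>u\<close>.\<close>

lemma fenchel_conjugate_finite:
  fixes g :: "'a::real_normed_vector \<Rightarrow> real"
  assumes "uniformly_frechet_differentiable g" and "0 < \<gamma>" and "strongly_convex \<gamma> g"
  shows "fenchel_conjugate (\<lambda>z. ereal (g z)) u < \<infinity>"
proof -
  define K where "K = norm (u - grad g 0)"
  have "blinfun_apply u z - g z \<le> K\<^sup>2 / (2 * \<gamma>) - g 0" for z
  proof -
    have 1: "\<gamma> / 2 * (norm z)\<^sup>2 \<le> g z - g 0 - blinfun_apply (grad g 0) z"
      using bregman_ge_norm_square[OF assms(1,3), of z 0] by (simp add: bregman_def)
    have 2: "blinfun_apply u z - blinfun_apply (grad g 0) z \<le> K * norm z"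
      using norm_blinfun[of "u - grad g 0" z] by (simp add: K_def blinfun.diff_left)
    \<comment> \<open>Completing the square: \<open>K * s - \<gamma> / 2 * s\<^sup>2\<close> has
      maximum \<open>K\<^sup>2 / (2 * \<gamma>)\<close>, attained at
      \<open>s = K / \<gamma>\<close>.\<close>
    have "0 \<le> (K - \<gamma> * norm z)\<^sup>2 / (2 * \<gamma>)" using assms(2) by simp
    also have "\<dots> = K\<^sup>2 / (2 * \<gamma>) - K * norm z + \<gamma> / 2 * (norm z)\<^sup>2"
      using assms(2) by (simp add: field_simps power2_eq_square)
    finally show ?thesis using 1 2 by linarith
  qed
  then have "fenchel_conjugate (\<lambda>z. ereal (g z)) u \<le> ereal (K\<^sup>2 / (2 * \<gamma>) - g 0)"
    unfolding fenchel_conjugate_def by (intro SUP_least) simp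
  then show ?thesis by (auto intro: le_less_trans)
qed

text \<open>The biconjugate theorem is not needed: at \<open>x = \<nabla>g\<^sup>*(u)\<close> the conjugate is known exactly at
  \<open>\<nabla>g(x)\<close>, and the subgradient inequality of \<open>g\<^sup>*\<close> between \<open>u\<close> and \<open>\<nabla>g(x)\<close> shows that \<open>x\<close> maximises
  \<open>u - g\<close>.\<close>
lemma grad_grad_conjugate:
  fixes g :: "'a::real_normed_vector \<Rightarrow> real"
  assumes refl: "reflexive TYPE('a)" and diff: "uniformly_frechet_differentiable g"
    and "0 < \<gamma>" and "strongly_convex \<gamma> g" and leg: "legendre (\<lambda>x. ereal (g x))"
  shows "grad g (grad_conjugate g u) = u"
proof -
  let ?f = "fenchel_conjugate (\<lambda>x. ereal (g x))"
  have fin: "?f w < \<infinity>" for w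
    using fenchel_conjugate_finite[OF diff] assms by blast
  have "\<exists>r. ?f w = ereal r" for w
    using fenchel_conjugate_real[OF fin[of w]] by blast
  then obtain G where G: "\<And>w. ?f w = ereal (G w)" by metis
  have "effective_domain ?f = UNIV" using fin by (auto simp: effective_domain_def)
  then have "gateaux_differentiable_at ?f u" using leg by (auto simp: legendre_def)
  then have grad: "has_gateaux_gradient ?f (gateaux_gradient ?f u) u"
    by (rule gateaux_gradient_has_gradient)
  define x where "x = grad_conjugate g u"
  \<comment> \<open>Reflexivity makes the canonical embedding surjective, so \<open>inv\<close> is a
    genuine right inverse.\<close>
  have J: "bidual_embedding x = gateaux_gradient ?f u"
    unfolding x_def grad_conjugate_def using refl by (simp add: reflexive_def surj_f_inv_f)
  have "?f = (\<lambda>w. ereal (G w))" using G by auto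
  then have "has_gateaux_gradient (\<lambda>w. ereal (G w)) (bidual_embedding x) u"
    using grad J by metis
  then have "G u + blinfun_apply (bidual_embedding x) (grad g x - u) \<le> G (grad g x)"
    by (rule gateaux_gradient_le_if_convex[OF convex_on_fenchel_conjugate[OF G]])
  then have sub: "G u + (blinfun_apply (grad g x) x - blinfun_apply u x) \<le> G (grad g x)"
    by (simp add: bidual_embedding.rep_eq blinfun.diff_left)
  have "0 \<le> bregman g z y" for z y
    using bregman_ge_norm_square[OF diff assms(4), of z y] \<open>0 < \<gamma>\<close>
    by (meson divide_nonneg_nonneg less_imp_le mult_nonneg_nonneg order_trans zero_le_numeral
        zero_le_power2)
  then have "g x + blinfun_apply (grad g x) (z - x) \<le> g z" for z
    by (simp add: bregman_def algebra_simps)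
  then have "G (grad g x) = blinfun_apply (grad g x) x - g x"
    using fenchel_conjugate_at_gradient[of g x "grad g x"] G by simp
  \<comment> \<open>The terms with \<open>grad g x\<close> cancel. Hence the supremum defining
    \<open>G u\<close> is attained at \<open>x\<close>, which makes \<open>u\<close> a subgradient
    of \<open>g\<close> at \<open>x\<close>.\<close>
  then have le: "G u \<le> blinfun_apply u x - g x" using sub by simp
  have "g x + blinfun_apply u (z - x) \<le> g z" for z
  proof -
    have "ereal (blinfun_apply u z - g z) \<le> ?f u"
      unfolding fenchel_conjugate_def by (rule SUP_upper2[of z]) auto
    then have "blinfun_apply u z - g z \<le> G u" by (simp add: G)
    then show ?thesis using le by (simp add: blinfun.diff_right)
  qed
  then show ?thesis
    using gateaux_gradient_eq_subgradient[OF has_gateaux_gradient_grad[OF diff]]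
    unfolding x_def by blast
qed

section \<open>Two convergence criteria for real sequences\<close>

lemma almost_decreasing_convergent:
  fixes a e :: "nat \<Rightarrow> real"
  assumes step: "\<And>n. a (Suc n) \<le> a n + e n" and nonneg: "\<And>n. 0 \<le> e n" and sum: "summable e"
    and low: "\<And>n. m \<le> a n"
  shows "convergent a"
proof -
  \<comment> \<open>Subtracting the accumulated errors leaves a decreasing sequence, bounded below
    because the errors have a finite sum.\<close>
  define c where "c n = a n - (\<Sum>k<n. e k)" for n
  have dec: "decseq c"
    using step by (auto simp: decseq_Suc_iff c_def algebra_simps)
  have "m - suminf e \<le> c n" for n
    using low[of n] sum_le_suminf[OF sum, of "{..<n}"] nonneg by (auto simp: c_def)
  then have "convergent c" using decseq_convergent[OF dec] convergentI by metis
  moreover have "convergent (\<lambda>n. \<Sum>k<n. e k)"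
    using sum by (simp add: summable_iff_convergent)
  ultimately have "convergent (\<lambda>n. c n + (\<Sum>k<n. e k))" by (rule convergent_add)
  then show ?thesis by (simp add: c_def)
qed

text \<open>From \<open>N\<close> on, \<open>b\<close> is squeezed between 0 and the consecutive
  differences of a convergent sequence.\<close>

lemma decrement_tendsto_zero:
  fixes a b :: "nat \<Rightarrow> real"
  assumes "\<And>n. N \<le> n \<Longrightarrow> 0 \<le> a n" and b: "\<And>n. 0 \<le> b n"
    and step: "\<And>n. N \<le> n \<Longrightarrow> a (Suc n) + b n \<le> a n"
  shows "b \<longlonglongrightarrow> 0"
proof -
  have "decseq (\<lambda>n. a (n + N))"
    unfolding decseq_Suc_iff
  proof
    fix n
    show "a (Suc n + N) \<le> a (n + N)" using step[of "n + N"] b[of "n + N"] by simp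
  qed
  then obtain l where l: "(\<lambda>n. a (n + N)) \<longlonglongrightarrow> l"
    using decseq_convergent[of "\<lambda>n. a (n + N)" 0] assms(1) by (metis le_add2)
  have "(\<lambda>n. a (n + N) - a (Suc n + N)) \<longlonglongrightarrow> l - l"
    by (intro tendsto_diff l LIMSEQ_Suc[OF l])
  moreover have "b (n + N) \<le> a (n + N) - a (Suc n + N)" for n
    using step[of "n + N"] by simp
  ultimately have "(\<lambda>n. b (n + N)) \<longlonglongrightarrow> 0"
    using b by (intro tendsto_sandwich[of "\<lambda>_. 0" "\<lambda>n. b (n + N)"]) auto
  then show ?thesis by (rule LIMSEQ_offset)
qed

section \<open>Strong convergence of the iteration\<close>

theorem theorem4p14:
  fixes g :: "'a::banach \<Rightarrow> real"
    and A :: "'a \<Rightarrow> ('a \<Rightarrow>\<^sub>L real)"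
    and B :: "'a \<Rightarrow> ('a \<Rightarrow>\<^sub>L real) set"
    and \<gamma> L \<tau> \<alpha> \<delta> :: real
    and \<mu> d :: "nat \<Rightarrow> real"
    and v :: "nat \<Rightarrow> 'a"
  assumes "reflexive TYPE('a)"
    and "proper_function (\<lambda>x. ereal (g x))"
    and "convex_on UNIV g"
    and "lower_semicontinuous (\<lambda>x. ereal (g x))"
    and "uniformly_frechet_differentiable g"
    and "\<gamma> > 0" and "strongly_convex \<gamma> g"
    and "strongly_coercive g"
    and "legendre (\<lambda>x. ereal (g x))"
    and "L > 0" and "L-lipschitz_on UNIV A"
    and "\<tau> > 0"
    and "(monotone_mapping A \<and> maximal_monotone B \<and> strongly_monotone_op \<tau> B) \<or>
         (strongly_monotone_mapping \<tau> A \<and> maximal_monotone B)"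
    and "zeros_of_sum A B \<noteq> {}"
    and "\<delta> \<in> {0<..<1/2}"
    and "\<alpha> \<in> {0<..<1}" and "\<alpha> \<in> {\<delta><..<\<gamma> * (1 - 2 * \<delta>) / 2}"
    and "\<mu> 0 > 0" and "\<mu> 1 > 0"
    and "\<And>n. n \<ge> 1 \<Longrightarrow> d n \<ge> 0" and "summable (\<lambda>n. d (Suc n))"
    and "\<And>n. n \<ge> 1 \<Longrightarrow>
           v (n + 1) \<in> resolvent g (\<mu> n) B
             (grad_conjugate g
               (grad g (v n)
                 - ((\<mu> n + \<mu> (n - 1)) *\<^sub>R A (v n) - \<mu> (n - 1) *\<^sub>R A (v (n - 1)))))"
    and "\<And>n. n \<ge> 1 \<Longrightarrow>
           \<mu> (n + 1) =
             (if A (v n) \<noteq> A (v (n + 1))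
              then min (\<alpha> * norm (v n - v (n + 1)) / norm (A (v n) - A (v (n + 1)))) (\<mu> n + d n)
              else \<mu> n + d n)"
  shows "\<exists>u \<in> zeros_of_sum A B. v \<longlonglongrightarrow> u"
proof -
  obtain u where u: "u \<in> zeros_of_sum A B" using assms(14) by blast
  then have Bu: "- A u \<in> B u"
    by (auto simp: zeros_of_sum_def op_inverse_def add_eq_0_iff)
  have breg: "\<gamma> / 2 * (norm (x - y))\<^sup>2 \<le> bregman g x y" for x y
    using bregman_ge_norm_square assms by blast
  have \<alpha>: "0 < \<alpha>" using assms by simp
  \<comment> \<open>As \<delta> > 0, \<alpha> stays strictly below \<gamma>/2; the gap leaves room
    for \<beta>, which absorbs the ratio of consecutive step sizes.\<close>
  have "\<gamma> * (1 - 2 * \<delta>) / 2 \<le> \<gamma> / 2" using assms by simp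
  then have "\<alpha> < \<gamma> / 2" using assms(17) by auto
  then obtain \<beta> where \<beta>: "\<alpha> < \<beta>" "\<beta> < \<gamma> / 2" using dense by blast
  have \<beta>0: "0 < \<beta>" using \<alpha> \<beta> by simp

  have A_lip: "norm (A x - A y) \<le> L * norm (x - y)" for x y
    using lipschitz_onD[OF assms(11), of x y] by (simp add: dist_norm)
  \<comment> \<open>By the Lipschitz bound the quotient in the step-size rule is at least
    \<open>\<alpha> / L\<close>, and the other branch never decreases the step, so \<open>m\<close>
    bounds all steps from index 1 on.\<close>
  define m where "m = min (\<alpha> / L) (\<mu> 1)"
  have m: "0 < m" using \<alpha> assms by (simp add: m_def)
  have low: "m \<le> \<mu> (Suc n)" for n
  proof (induction n)
    case 0
    then show ?case by (simp add: m_def)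
  next
    case (Suc n)
    have d: "0 \<le> d (Suc n)" using assms(20) by simp
    show ?case
    proof (cases "A (v (Suc n)) = A (v (Suc (Suc n)))")
      case True
      then show ?thesis using Suc d assms(23)[of "Suc n"] by simp
    next
      case False
      have "m \<le> \<alpha> / L" by (simp add: m_def)
      also have "\<dots> \<le> \<alpha> * norm (v (Suc n) - v (Suc (Suc n)))
          / norm (A (v (Suc n)) - A (v (Suc (Suc n))))"
        using False \<alpha> assms(10) A_lip[of "v (Suc n)" "v (Suc (Suc n))"] by (simp add: field_simps)
      finally show ?thesis using False Suc d assms(23)[of "Suc n"] by simp
    qed
  qed
  have pos: "0 < \<mu> n" for n
    using low m assms(18) by (cases n) (auto intro: less_le_trans)
  have "convergent (\<lambda>n. \<mu> (Suc n))"
  proof (rule almost_decreasing_convergent[where e = "\<lambda>n. d (Suc n)" and m = m])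
    fix n
    show "\<mu> (Suc (Suc n)) \<le> \<mu> (Suc n) + d (Suc n)"
      using assms(23)[of "Suc n"] by (simp split: if_splits)
  qed (use low assms(20,21) in auto)
  then obtain M where M: "(\<lambda>n. \<mu> (Suc n)) \<longlonglongrightarrow> M" by (auto simp: convergent_def)
  then have "m \<le> M" using low by (intro LIMSEQ_le_const) auto
  \<comment> \<open>The limit \<open>M\<close> is positive, hence consecutive step sizes have ratio
    tending to 1.\<close>
  then have "(\<lambda>n. \<alpha> * (\<mu> (Suc n) / \<mu> (Suc (Suc n)))) \<longlonglongrightarrow> \<alpha> * (M / M)"
    using m by (intro tendsto_intros M LIMSEQ_Suc[OF M]) auto
  then have "(\<lambda>n. \<alpha> * (\<mu> (Suc n) / \<mu> (Suc (Suc n)))) \<longlonglongrightarrow> \<alpha>" using m \<open>m \<le> M\<close> by simp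
  then have "eventually (\<lambda>n. \<alpha> * (\<mu> (Suc n) / \<mu> (Suc (Suc n))) < \<beta>) sequentially"
    using \<beta> by (intro order_tendstoD(2))
  then obtain N0 where N0: "\<And>n. N0 \<le> n \<Longrightarrow> \<alpha> * (\<mu> (Suc n) / \<mu> (Suc (Suc n))) < \<beta>"
    by (auto simp: eventually_sequentially)

  define a where "a n = \<mu> n *\<^sub>R (A (v (Suc n)) - A (v n))" for n
  define p where "p n = norm (v (Suc n) - v n)" for n
  have a_bound: "norm (a n) \<le> \<beta> * p n" if n: "Suc N0 \<le> n" for n
  proof -
    obtain k where k: "n = Suc k" "N0 \<le> k" using n by (cases n) auto
    \<comment> \<open>The step-size rule controls this difference of \<open>A\<close> with the
      weight \<open>\<mu> (Suc n)\<close>, whereas \<open>a n\<close> carries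
      \<open>\<mu> n\<close>; the exchange costs the ratio bounded by \<open>N0\<close>.\<close>
    have "\<mu> (Suc n) * norm (A (v (Suc n)) - A (v n)) \<le> \<alpha> * p n"
    proof (cases "A (v (Suc n)) = A (v n)")
      case True
      then show ?thesis using \<alpha> by (simp add: p_def)
    next
      case False
      then have "\<mu> (Suc n) \<le> \<alpha> * norm (v n - v (Suc n)) / norm (A (v n) - A (v (Suc n)))"
        using assms(23)[of n] k by auto
      then show ?thesis using False by (simp add: p_def norm_minus_commute field_simps)
    qed
    then have "norm (A (v (Suc n)) - A (v n)) \<le> \<alpha> * p n / \<mu> (Suc n)"
      using pos[of "Suc n"] by (simp add: field_simps)
    then have "norm (a n) \<le> \<mu> n * (\<alpha> * p n / \<mu> (Suc n))"
      using mult_left_mono[of _ _ "\<mu> n"] pos[of n] by (fastforce simp: a_def)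
    also have "\<dots> = \<alpha> * (\<mu> n / \<mu> (Suc n)) * p n" by simp
    also have "\<dots> \<le> \<beta> * p n"
      using N0[OF k(2)] k(1) by (intro mult_right_mono) (auto simp: p_def)
    finally show ?thesis .
  qed
  have a_apply: "\<bar>blinfun_apply (a n) y\<bar> \<le> \<beta> / 2 * ((p n)\<^sup>2 + (norm y)\<^sup>2)" if "Suc N0 \<le> n" for n y
  proof -
    have "\<bar>blinfun_apply (a n) y\<bar> \<le> norm (a n) * norm y"
      using norm_blinfun[of "a n" y] by simp
    also have "\<dots> \<le> \<beta> * p n * norm y" using a_bound[OF that] by (intro mult_right_mono) auto
    also have "\<dots> \<le> \<beta> / 2 * ((p n)\<^sup>2 + (norm y)\<^sup>2)"
      using mult_left_mono[OF sum_squares_bound[of "p n" "norm y"], of "\<beta> / 2"] \<beta>0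
      by (simp add: mult.assoc)
    finally show ?thesis .
  qed

  have ineq: "\<mu> (Suc n) * (\<tau> * (norm (v (Suc (Suc n)) - u))\<^sup>2)
      \<le> blinfun_apply (grad g (v (Suc n)) - grad g (v (Suc (Suc n))) + a (Suc n) - a n)
          (v (Suc (Suc n)) - u)" for n
  proof -
    let ?z = "v (Suc (Suc n))"
    obtain b where b: "b \<in> B ?z" and eq: "grad g ?z + \<mu> (Suc n) *\<^sub>R b
        = grad g (v (Suc n)) - ((\<mu> (Suc n) + \<mu> n) *\<^sub>R A (v (Suc n)) - \<mu> n *\<^sub>R A (v n))"
      using assms(22)[of "Suc n"]
      unfolding resolvent_def op_inverse_def grad_grad_conjugate[OF assms(1,5,6,7,9)] by auto
    \<comment> \<open>\<open>- A u\<close> is the element of \<open>B u\<close> paired with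
      \<open>b\<close>. In each alternative one operator supplies the \<tau> term and the other a
      nonnegative one.\<close>
    have "\<tau> * (norm (?z - u))\<^sup>2 \<le> blinfun_apply (b + A ?z) (?z - u)"
      using assms(13)
    proof
      assume h: "monotone_mapping A \<and> maximal_monotone B \<and> strongly_monotone_op \<tau> B"
      then have "0 \<le> blinfun_apply (A ?z - A u) (?z - u)" by (simp add: monotone_mapping_def)
      moreover have "\<tau> * (norm (?z - u))\<^sup>2 \<le> blinfun_apply (b - - A u) (?z - u)"
        using h b Bu unfolding strongly_monotone_op_def by blast
      ultimately show ?thesis
        by (simp add: blinfun.diff_left blinfun.add_left blinfun.minus_left)
    next
      assume h: "strongly_monotone_mapping \<tau> A \<and> maximal_monotone B"
      then have "\<tau> * (norm (?z - u))\<^sup>2 \<le> blinfun_apply (A ?z - A u) (?z - u)"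
        by (simp add: strongly_monotone_mapping_def)
      moreover have "0 \<le> blinfun_apply (b - - A u) (?z - u)"
        using h b Bu unfolding maximal_monotone_def monotone_op_def by blast
      ultimately show ?thesis
        by (simp add: blinfun.diff_left blinfun.add_left blinfun.minus_left)
    qed
    then have "\<mu> (Suc n) * (\<tau> * (norm (?z - u))\<^sup>2)
        \<le> blinfun_apply (\<mu> (Suc n) *\<^sub>R (b + A ?z)) (?z - u)"
      using pos[of "Suc n"] by (simp add: blinfun.scaleR_left mult_left_mono)
    \<comment> \<open>The extrapolated values of \<open>A\<close> in the scheme are arranged so that
      the correction telescopes as \<open>a (Suc n) - a n\<close>.\<close>
    moreover have "\<mu> (Suc n) *\<^sub>R (b + A ?z)
        = grad g (v (Suc n)) - grad g ?z + a (Suc n) - a n"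
    proof -
      have "\<mu> (Suc n) *\<^sub>R b = grad g (v (Suc n))
          - ((\<mu> (Suc n) + \<mu> n) *\<^sub>R A (v (Suc n)) - \<mu> n *\<^sub>R A (v n)) - grad g ?z"
        using eq by (metis add_diff_cancel_left')
      then show ?thesis by (simp add: a_def algebra_simps)
    qed
    ultimately show ?thesis by simp
  qed

  define \<Phi> where "\<Phi> n = bregman g u (v (Suc n)) - blinfun_apply (a n) (v (Suc n) - u)
      + \<beta> / 2 * (p n)\<^sup>2" for n
  have "(\<lambda>n. m * \<tau> * (norm (v (Suc (Suc n)) - u))\<^sup>2) \<longlonglongrightarrow> 0"
  proof (rule decrement_tendsto_zero)
    fix n assume n: "Suc N0 \<le> n"
    \<comment> \<open>Of the two squares bounding the \<open>a n\<close> term, the Bregman distance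
      absorbs this one and the last summand of \<open>\<Phi> n\<close> the other.\<close>
    have "\<beta> / 2 * (norm (v (Suc n) - u))\<^sup>2 \<le> \<gamma> / 2 * (norm (v (Suc n) - u))\<^sup>2"
      using \<beta> \<beta>0 by (intro mult_right_mono) auto
    also have "\<dots> \<le> bregman g u (v (Suc n))"
      using breg[of u "v (Suc n)"] by (simp add: norm_minus_commute)
    finally show "0 \<le> \<Phi> n"
      using a_apply[OF n, of "v (Suc n) - u"] unfolding \<Phi>_def distrib_left by linarith
    let ?y = "v (Suc n)" and ?z = "v (Suc (Suc n))"
    have "m * \<tau> * (norm (?z - u))\<^sup>2 \<le> \<mu> (Suc n) * (\<tau> * (norm (?z - u))\<^sup>2)"
      using low[of n] assms(12) unfolding mult.assoc by (intro mult_right_mono) auto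
    \<comment> \<open>The distance from \<open>?y\<close> to \<open>?z\<close> must pay for
      \<open>\<beta> / 2 * (p (Suc n))\<^sup>2\<close> twice: once in \<open>\<Phi> (Suc n)\<close>
      and once in the bound on \<open>a n\<close> at \<open>?z - ?y\<close>. This is why \<beta> <
      \<gamma>/2 is required.\<close>
    moreover have "\<beta> * (p (Suc n))\<^sup>2 \<le> \<gamma> / 2 * (p (Suc n))\<^sup>2"
      using \<beta> by (intro mult_right_mono) auto
    moreover have "\<gamma> / 2 * (p (Suc n))\<^sup>2 \<le> bregman g ?z ?y"
      using breg[of ?z ?y] by (simp add: p_def)
    moreover have "\<bar>blinfun_apply (a n) (?z - ?y)\<bar> \<le> \<beta> / 2 * (p n)\<^sup>2 + \<beta> / 2 * (p (Suc n))\<^sup>2"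
      using a_apply[OF n, of "?z - ?y"] by (simp add: p_def distrib_left)
    \<comment> \<open>Splitting at \<open>?y\<close> recovers the pairing that occurs in
      \<open>\<Phi> n\<close>.\<close>
    moreover have "blinfun_apply (a n) (?z - u)
        = blinfun_apply (a n) (?z - ?y) + blinfun_apply (a n) (?y - u)"
      by (simp add: blinfun.diff_right)
    ultimately show "\<Phi> (Suc n) + m * \<tau> * (norm (?z - u))\<^sup>2 \<le> \<Phi> n"
      using ineq[of n] bregman_three_point[of g ?y ?z u]
      unfolding \<Phi>_def blinfun.add_left blinfun.diff_left by linarith
  qed (use m assms(12) in auto)
  then have "(\<lambda>n. m * \<tau> * (norm (v (Suc (Suc n)) - u))\<^sup>2 / (m * \<tau>)) \<longlonglongrightarrow> 0 / (m * \<tau>)"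
    using m assms(12) by (intro tendsto_divide tendsto_const) auto
  then have "(\<lambda>n. (norm (v (Suc (Suc n)) - u))\<^sup>2) \<longlonglongrightarrow> 0"
    using m assms(12) by simp
  then have "(\<lambda>n. norm (v (n + 2) - u)) \<longlonglongrightarrow> 0"
    by simp
  then have "(\<lambda>n. v (n + 2)) \<longlonglongrightarrow> u"
    by (simp only: tendsto_norm_zero_iff LIM_zero_iff)
  then have "v \<longlonglongrightarrow> u" by (rule LIMSEQ_offset)
  with u show ?thesis by blast
qed

end
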